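(* Let the grid $\lambda:\mathbb{Z}\to\mathbb{C}$, $x\mapsto\lambda_x$, be of one of the following forms, for some constants $\alpha,\beta,\kappa\in\mathbb{C}$ (and $q\in\mathbb{C}\setminus\{0\}$): $$\lambda_x=\alpha q^{x}+\beta q^{-x}+\kappa,\qquad \lambda_x=\alpha x^2+\beta x+\kappa,\qquad\text{or}\qquad \lambda_x=(-1)^x(\alpha x+\beta)+\kappa .$$ Then every S--Heun operator $S\in\mathcal{SH}$ on $\lambda$ (i.e. for every choice of the five parameters $u_0,\dots,u_4\in\mathbb{C}$) has the degree-raising property: for every $n\ge 0$ and every polynomial $p$ of degree at most $n$ there is a polynomial $q_{n+1}$ of degree at most $n+1$ such that $$A_1(x)\,p(\lambda_{x+1})+A_2(x)\,p(\lambda_{x-1})=q_{n+1}(\lambda_x)$$ for all $x$ with $\lambda_{x+1}\ne\lambda_{x-1}$.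
   Context: Let $\lambda_x$ be a discrete grid indexed by $x$, with shift operators $T^{\pm}f(\lambda_x)=f(\lambda_{x\pm1})$. The set $\mathcal{SH}$ of S--Heun operators on $\lambda$ is the set of operators $S=A_1T^{+}+A_2T^{-}$ (second order, no diagonal term) whose coefficients have the form $$A_1(x)=\frac{u_2+u_3\lambda_x+u_4\lambda_x^2-u_0\lambda_{x-1}-u_1\lambda_{x-1}\lambda_x}{\lambda_{x+1}-\lambda_{x-1}},\qquad A_2(x)=-\frac{u_2+u_3\lambda_x+u_4\lambda_x^2-u_0\lambda_{x+1}-u_1\lambda_{x+1}\lambda_x}{\lambda_{x+1}-\lambda_{x-1}},$$ with $u_0,\dots,u_4\in\mathbb{C}$. Equivalently, $S\cdot 1=u_0+u_1\lambda_x$ and $S\cdot\lambda_x=u_2+u_3\lambda_x+u_4\lambda_x^2$. The coefficients are considered at those $x$ where $\lambda_{x+1}\neq\lambda_{x-1}$. *)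

theory Defs
  imports Complex_Main "HOL-Computational_Algebra.Polynomial"
begin

text \<open>
  A grid is a map \<open>lam :: int \<Rightarrow> complex\<close>.  Operators act on functions of the index \<open>x\<close>;
  a function \<open>f\<close> of the grid variable enters as \<open>\<lambda>x. f (lam x)\<close>, so that the shifts
  \<open>T\<^sup>\<plusminus> f (\<lambda>\<^sub>x) = f (\<lambda>\<^sub>x\<^sub>\<plusminus>\<^sub>1)\<close> are well defined even if \<open>lam\<close> is not injective.
\<close>

definition T_plus :: "(int \<Rightarrow> complex) \<Rightarrow> int \<Rightarrow> complex" where
  "T_plus f x = f (x + 1)"

definition T_minus :: "(int \<Rightarrow> complex) \<Rightarrow> int \<Rightarrow> complex" where
  "T_minus f x = f (x - 1)"

text \<open>
  The two coefficients are meaningful only where \<open>lam (x + 1) \<noteq> lam (x - 1)\<close>; elsewhere the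
  value \<open>0\<close> produced by division by zero has no significance.
\<close>

definition sheun_A1 ::
  "(int \<Rightarrow> complex) \<Rightarrow> complex \<Rightarrow> complex \<Rightarrow> complex \<Rightarrow> complex \<Rightarrow> complex \<Rightarrow> int \<Rightarrow> complex" where
  "sheun_A1 lam u0 u1 u2 u3 u4 x =
     (u2 + u3 * lam x + u4 * (lam x)^2 - u0 * lam (x - 1) - u1 * lam (x - 1) * lam x)
       / (lam (x + 1) - lam (x - 1))"

definition sheun_A2 ::
  "(int \<Rightarrow> complex) \<Rightarrow> complex \<Rightarrow> complex \<Rightarrow> complex \<Rightarrow> complex \<Rightarrow> complex \<Rightarrow> int \<Rightarrow> complex" where
  "sheun_A2 lam u0 u1 u2 u3 u4 x =
     - ((u2 + u3 * lam x + u4 * (lam x)^2 - u0 * lam (x + 1) - u1 * lam (x + 1) * lam x)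
         / (lam (x + 1) - lam (x - 1)))"

definition sheun_op ::
  "(int \<Rightarrow> complex) \<Rightarrow> complex \<Rightarrow> complex \<Rightarrow> complex \<Rightarrow> complex \<Rightarrow> complex
     \<Rightarrow> (int \<Rightarrow> complex) \<Rightarrow> int \<Rightarrow> complex" where
  "sheun_op lam u0 u1 u2 u3 u4 f x =
     sheun_A1 lam u0 u1 u2 u3 u4 x * T_plus f x + sheun_A2 lam u0 u1 u2 u3 u4 x * T_minus f x"

definition SHeun :: "(int \<Rightarrow> complex) \<Rightarrow> ((int \<Rightarrow> complex) \<Rightarrow> int \<Rightarrow> complex) set" where
  "SHeun lam = {S. \<exists>u0 u1 u2 u3 u4. S = sheun_op lam u0 u1 u2 u3 u4}"

lemma sheun_op_one:
  assumes "lam (x + 1) \<noteq> lam (x - 1)"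
  shows "sheun_op lam u0 u1 u2 u3 u4 (\<lambda>_. 1) x = u0 + u1 * lam x"
  using assms
  unfolding sheun_op_def sheun_A1_def sheun_A2_def T_plus_def T_minus_def
  by (simp add: divide_simps) (simp add: algebra_simps)

lemma sheun_op_grid:
  assumes "lam (x + 1) \<noteq> lam (x - 1)"
  shows "sheun_op lam u0 u1 u2 u3 u4 lam x = u2 + u3 * lam x + u4 * (lam x)^2"
  using assms
  unfolding sheun_op_def sheun_A1_def sheun_A2_def T_plus_def T_minus_def
  by (simp add: divide_simps) (simp add: algebra_simps)

end

(* On each of the three grids, the neighbours of lam x are the two roots of a quadratic
   z^2 - s(lam x) * z + m(lam x) with deg s <= 1 and deg m <= 2.  Hence the images
   R k of the monomials under S satisfy R (k + 2) = s * R (k + 1) - m * R k, and since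
   R 0 and R 1 have degrees at most 1 and 2, induction gives deg (R k) <= k + 1. *)

theory Submission
  imports Defs
begin

text \<open>Sum and product are recorded because each neighbour alone is in general not a polynomial
  in \<open>lam x\<close>.\<close>

definition quadratic_neighbours :: "(int \<Rightarrow> complex) \<Rightarrow> complex poly \<Rightarrow> complex poly \<Rightarrow> bool" where
  "quadratic_neighbours lam s m \<longleftrightarrow> degree s \<le> 1 \<and> degree m \<le> 2 \<and>
     (\<forall>x. lam (x + 1) + lam (x - 1) = poly s (lam x) \<and> lam (x + 1) * lam (x - 1) = poly m (lam x))"

lemma quadratic_neighboursI:
  assumes "\<And>x. lam (x + 1) + lam (x - 1) = s0 + s1 * lam x"
    and "\<And>x. lam (x + 1) * lam (x - 1) = m0 + m1 * lam x + m2 * (lam x)^2"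
  shows "quadratic_neighbours lam [:s0, s1:] [:m0, m1, m2:]"
  using assms by (simp add: quadratic_neighbours_def algebra_simps power2_eq_square)

text \<open>Put w = \<open>lam x\<close> - \<kappa>. A shift scales the two exponentials by q and
  1/q in opposite order, so the centred neighbours have sum t*w and product w^2 +
  \<alpha>*\<beta>*(q - 1/q)^2.\<close>

lemma quadratic_neighbours_exponential:
  fixes q :: complex
  assumes "q \<noteq> 0" and lam: "\<And>x. lam x = \<alpha> * q powi x + \<beta> * q powi (- x) + \<kappa>"
  shows "\<exists>s m. quadratic_neighbours lam s m"
proof -
  define t where "t = q + inverse q"
  have shift: "lam (x + 1) = \<alpha> * q * q powi x + \<beta> * inverse q * q powi (- x) + \<kappa>"
    "lam (x - 1) = \<alpha> * inverse q * q powi x + \<beta> * q * q powi (- x) + \<kappa>" for x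
    using \<open>q \<noteq> 0\<close> by (simp_all add: lam power_int_add power_int_diff power_int_minus field_simps)
  have inv: "q powi x * q powi (- x) = 1" "q * inverse q = 1" for x
    using \<open>q \<noteq> 0\<close> by (simp_all add: power_int_minus)
  have "lam (x + 1) + lam (x - 1) = \<kappa> * (2 - t) + t * lam x" for x
    unfolding shift t_def lam[of x] by (simp add: algebra_simps)
  \<comment> \<open>The explicit factor 1 supplies \<open>m2\<close> in
    \<open>quadratic_neighboursI\<close>. With the reciprocal relations \<open>inv\<close>, the
    claim is a polynomial identity.\<close>
  moreover have "lam (x + 1) * lam (x - 1) =
      (\<kappa>^2 * (2 - t) + \<alpha> * \<beta> * (q - inverse q)^2) + \<kappa> * (t - 2) * lam x + 1 * (lam x)^2" for x
    unfolding shift t_def lam[of x] using inv(1)[of x] inv(2) by algebra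
  ultimately show ?thesis using quadratic_neighboursI by blast
qed

text \<open>The neighbours are (\<open>lam x\<close> + \<alpha>) +- (2*\<alpha>*x + \<beta>), and
  completing the square gives (2*\<alpha>*x + \<beta>)^2 = 4*\<alpha>*(\<open>lam x\<close> -
  \<kappa>) + \<beta>^2.\<close>

lemma quadratic_neighbours_quadratic:
  assumes lam: "\<And>x. lam x = \<alpha> * (of_int x)^2 + \<beta> * of_int x + \<kappa>"
  shows "\<exists>s m. quadratic_neighbours lam s m"
proof -
  have "lam (x + 1) + lam (x - 1) = 2 * \<alpha> + 2 * lam x" for x
    by (simp add: lam algebra_simps power2_eq_square)
  moreover have "lam (x + 1) * lam (x - 1) =
      (4 * \<alpha> * \<kappa> + \<alpha>^2 - \<beta>^2) + (- 2 * \<alpha>) * lam x + 1 * (lam x)^2" for x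
    unfolding lam of_int_add of_int_diff of_int_1 by algebra
  ultimately show ?thesis using quadratic_neighboursI by blast
qed

text \<open>With w = \<open>lam x\<close> - \<kappa> and e = (-1)^x, the centred neighbours are -w -
  e*\<alpha> and -w + e*\<alpha>; since e^2 = 1, their product is w^2 - \<alpha>^2.\<close>

lemma quadratic_neighbours_alternating:
  assumes lam: "\<And>x. lam x = (- 1) powi x * (\<alpha> * of_int x + \<beta>) + \<kappa>"
  shows "\<exists>s m. quadratic_neighbours lam s m"
proof -
  have sgn: "((- 1) powi x)^2 = (1 :: complex)" for x :: int
    by (simp add: power_int_def power2_eq_square flip: power_mult_distrib)
  have shift: "lam (x + 1) = - ((- 1) powi x) * (\<alpha> * of_int x + \<alpha> + \<beta>) + \<kappa>"
    "lam (x - 1) = - ((- 1) powi x) * (\<alpha> * of_int x - \<alpha> + \<beta>) + \<kappa>" for x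
    by (simp_all add: lam power_int_add power_int_diff algebra_simps)
  have "lam (x + 1) + lam (x - 1) = 4 * \<kappa> + (- 2) * lam x" for x
    unfolding shift lam[of x] by (simp add: algebra_simps)
  moreover have "lam (x + 1) * lam (x - 1) =
      (4 * \<kappa>^2 - \<alpha>^2) + (- 4 * \<kappa>) * lam x + 1 * (lam x)^2" for x
    unfolding shift lam[of x] using sgn[of x] by algebra
  ultimately show ?thesis using quadratic_neighboursI by blast
qed

lemma SHeun_add:
  assumes "S \<in> SHeun lam"
  shows "S (\<lambda>y. f y + g y) x = S f x + S g x"
  using assms by (auto simp: SHeun_def sheun_op_def T_plus_def T_minus_def algebra_simps)

lemma SHeun_cmult:
  assumes "S \<in> SHeun lam"
  shows "S (\<lambda>y. c * f y) x = c * S f x"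
  using assms by (auto simp: SHeun_def sheun_op_def T_plus_def T_minus_def algebra_simps)

lemma SHeun_sum:
  assumes "S \<in> SHeun lam" and "finite I"
  shows "S (\<lambda>y. \<Sum>i\<in>I. c i * f i y) x = (\<Sum>i\<in>I. c i * S (f i) x)"
  using \<open>finite I\<close>
proof (induction I rule: finite_induct)
  case empty
  \<comment> \<open>The zero function is 0 times any function, so homogeneity sends it to 0.\<close>
  show ?case using SHeun_cmult[OF assms(1), of 0] by simp
next
  case (insert i I)
  then show ?case by (simp add: SHeun_add[OF assms(1)] SHeun_cmult[OF assms(1)])
qed

text \<open>\<open>S\<close> samples its argument only at the two neighbours. Each is a root z of
  z^2 = s*z - m; multiplying by z^k and adding with the weights of \<open>S\<close> gives the
  recurrence.\<close>

lemma SHeun_power_Suc_Suc: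
  assumes "S \<in> SHeun lam" and "quadratic_neighbours lam s m"
  shows "S (\<lambda>y. lam y ^ Suc (Suc k)) x =
    poly s (lam x) * S (\<lambda>y. lam y ^ Suc k) x - poly m (lam x) * S (\<lambda>y. lam y ^ k) x"
proof -
  have "poly s (lam x) = lam (x + 1) + lam (x - 1)" "poly m (lam x) = lam (x + 1) * lam (x - 1)"
    using assms(2) by (simp_all add: quadratic_neighbours_def)
  then show ?thesis
    using assms(1) by (auto simp: SHeun_def sheun_op_def T_plus_def T_minus_def algebra_simps)
qed

text \<open>One \<open>r\<close> serves all x, because the polynomials \<open>s\<close> and
  \<open>m\<close> in the recurrence do not depend on x.\<close>

lemma SHeun_power:
  assumes S: "S \<in> SHeun lam" and nb: "quadratic_neighbours lam s m"
  shows "\<exists>r. degree r \<le> k + 1 \<and>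
    (\<forall>x. lam (x + 1) \<noteq> lam (x - 1) \<longrightarrow> S (\<lambda>y. lam y ^ k) x = poly r (lam x))"
proof (induction k rule: induct_nat_012)
  case 0
  obtain u0 u1 u2 u3 u4 where "S = sheun_op lam u0 u1 u2 u3 u4"
    using S by (auto simp: SHeun_def)
  \<comment> \<open>The witness is the prescribed image of the constant 1; in the next case it is
    that of \<open>lam\<close>.\<close>
  then show ?case by (intro exI[of _ "[:u0, u1:]"]) (simp add: sheun_op_one)
next
  case 1
  obtain u0 u1 u2 u3 u4 where "S = sheun_op lam u0 u1 u2 u3 u4"
    using S by (auto simp: SHeun_def)
  then show ?case
    by (intro exI[of _ "[:u2, u3, u4:]"]) (simp add: sheun_op_grid algebra_simps power2_eq_square)
next
  case (ge2 k)
  obtain r where r: "degree r \<le> k + 1"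
    "\<And>x. lam (x + 1) \<noteq> lam (x - 1) \<Longrightarrow> S (\<lambda>y. lam y ^ k) x = poly r (lam x)"
    using ge2(1) by blast
  obtain r' where r': "degree r' \<le> Suc k + 1"
    "\<And>x. lam (x + 1) \<noteq> lam (x - 1) \<Longrightarrow> S (\<lambda>y. lam y ^ Suc k) x = poly r' (lam x)"
    using ge2(2) by blast
  have "degree s \<le> 1" "degree m \<le> 2"
    using nb by (simp_all add: quadratic_neighbours_def)
  \<comment> \<open>The bounds add up as 1 + (k + 2) and 2 + (k + 1).\<close>
  then have "degree (s * r') \<le> k + 3" "degree (m * r) \<le> k + 3"
    using r(1) r'(1) degree_mult_le[of s r'] degree_mult_le[of m r] by simp_all
  then have "degree (s * r' - m * r) \<le> Suc (Suc k) + 1"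
    using degree_diff_le by fastforce
  moreover have "S (\<lambda>y. lam y ^ Suc (Suc k)) x = poly (s * r' - m * r) (lam x)"
    if "lam (x + 1) \<noteq> lam (x - 1)" for x
    using r(2)[OF that] r'(2)[OF that] SHeun_power_Suc_Suc[OF S nb] by simp
  ultimately show ?case by blast
qed

theorem proposition1:
  fixes lam :: "int \<Rightarrow> complex" and S :: "(int \<Rightarrow> complex) \<Rightarrow> int \<Rightarrow> complex"
    and n :: nat and p :: "complex poly"
  assumes grid:
    "(\<exists>\<alpha> \<beta> \<kappa> q :: complex. q \<noteq> 0 \<and>
        (\<forall>x. lam x = \<alpha> * q powi x + \<beta> * q powi (- x) + \<kappa>)) \<or>
     (\<exists>\<alpha> \<beta> \<kappa> :: complex. \<forall>x. lam x = \<alpha> * (of_int x)^2 + \<beta> * of_int x + \<kappa>) \<or>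
     (\<exists>\<alpha> \<beta> \<kappa> :: complex. \<forall>x. lam x = (- 1) powi x * (\<alpha> * of_int x + \<beta>) + \<kappa>)"
    and S: "S \<in> SHeun lam"
    and p: "degree p \<le> n"
  shows "\<exists>r :: complex poly. degree r \<le> n + 1 \<and>
           (\<forall>x. lam (x + 1) \<noteq> lam (x - 1) \<longrightarrow> S (\<lambda>y. poly p (lam y)) x = poly r (lam x))"
proof -
  obtain s m where nb: "quadratic_neighbours lam s m"
    using grid quadratic_neighbours_exponential quadratic_neighbours_quadratic
      quadratic_neighbours_alternating by metis
  obtain R where R: "\<And>k. degree (R k) \<le> k + 1"
    "\<And>k x. lam (x + 1) \<noteq> lam (x - 1) \<Longrightarrow> S (\<lambda>y. lam y ^ k) x = poly (R k) (lam x)"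
    using SHeun_power[OF S nb] by metis
  \<comment> \<open>By linearity, the image of \<open>p\<close> combines the images
    \<open>R k\<close> of the monomials with the coefficients of \<open>p\<close>; only k \<le>
    \<open>degree p\<close> \<le> n occur, so each term has degree at most n + 1.\<close>
  define r where "r = (\<Sum>k\<le>degree p. smult (coeff p k) (R k))"
  have "degree (smult (coeff p k) (R k)) \<le> n + 1" if "k \<le> degree p" for k
    using that R(1)[of k] p degree_smult_le[of "coeff p k" "R k"] by linarith
  then have "degree r \<le> n + 1"
    unfolding r_def by (intro degree_sum_le) auto
  moreover have "S (\<lambda>y. poly p (lam y)) x = poly r (lam x)"
    if "lam (x + 1) \<noteq> lam (x - 1)" for x
    using R(2)[OF that] by (simp add: poly_altdef[of p] SHeun_sum[OF S] r_def poly_sum)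
  ultimately show ?thesis by blast
qed

end
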